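(* Let $A_1,\ldots,A_n:\mathcal H\rightrightarrows\mathcal H$ be maximally monotone operators on a real Hilbert space $\mathcal H$ with $\operatorname{zer}(\sum_{i=1}^nA_i)\neq\emptyset$, let $G=(\mathcal N,\mathcal E)$ be an algorithmic graph of order $n\ge 2$, let $G'=(\mathcal N,\mathcal E')$ be a connected spanning subgraph of $G$, and let $Z\in\mathbb R^{n\times(n-1)}$ be an onto decomposition of $\operatorname{Lap}(G')$, i.e. $\operatorname{Lap}(G')=ZZ^*$. Let $\boldsymbol\delta\in\mathbb R^n$ be the degree balance of $G$, and let $\mathcal T=(\mathcal M+\mathcal A)^{-1}\mathcal M$ and $\widetilde{\mathcal T}=\mathcal C^*(\mathcal M+\mathcal A)^{-1}\mathcal C$ be the operators defined in the context. Then the fixed points of $\mathcal T$ and $\widetilde{\mathcal T}$ are given by $$\operatorname{Fix}\mathcal T=\{((\mathbf 1_n)_\otimes x,\boldsymbol v)\in\mathcal H^{2n-1}\mid Z_\otimes\boldsymbol v\in\mathcal A_n(x)+\boldsymbol\delta_\otimes x\},$$ $$\operatorname{Fix}\widetilde{\mathcal T}=\{\boldsymbol v\in\mathcal H^{n-1}\mid Z_\otimes\boldsymbol v\in\mathcal A_n(x)+\boldsymbol\delta_\otimes x,\ \text{with }x\in\mathcal H\}.$$ What is more, for all $\boldsymbol v\in\mathcal H^{n-1}$, the inclusion $Z_\otimes\boldsymbol v\in\mathcal A_n(x)+\boldsymbol\delta_\otimes x$ has a unique solution given by $$x_{\boldsymbol v}=J_{\frac1{d_1}A_1}\left(\frac{(Z_\otimes\boldsymbol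 v)_1}{d_1}\right),$$ which implies $x_{\boldsymbol v}\in\operatorname{zer}(\sum_{i=1}^nA_i)$.
   Context: $\mathcal H$ is a real Hilbert space and $\mathcal H^m$ carries the inner product $\langle\boldsymbol x,\boldsymbol y\rangle=\sum_i\langle x_i,y_i\rangle$. A set-valued $A:\mathcal H\rightrightarrows\mathcal H$ is monotone if $\langle x-y,u-v\rangle\ge0$ whenever $u\in A(x)$, $v\in A(y)$, and maximally monotone if its graph is not properly contained in the graph of another monotone operator. $\operatorname{zer}A=\{x\mid 0\in A(x)\}$ and $J_A=(\mathrm{Id}+A)^{-1}$ (inverse as a set-valued map) is the resolvent. For a single-valued $T$, $\operatorname{Fix}T=\{x\mid T(x)=x\}$. Graphs: an algorithmic graph of order $n\ge2$ is a directed graph $G=(\mathcal N,\mathcal E)$ with $\mathcal N=\{1,\ldots,n\}$, $\mathcal E\subseteq\mathcal N\times\mathcal N$, $(i,j)\in\mathcal E\Rightarrow i<j$, and $G$ connected (ignoring edge directions). $G'=(\mathcal N,\mathcal E')$ is a spanning subgraph of $G$ if $\mathcal E'\subseteq\mathcal E$. $d_i^{\rm in}=|\{j:(j,i)\in\mathcal E\}|$, $d_i^{\rm out}=|\{j:(i,j)\in\mathcal E\}|$, $d_i=d_i^{\rm in}+d_i^{\rm out}$ are the degrees in $G$. Two nodes $i,j$ are adjacent if $(i,j)$ or $(j,i)$ is an edge. The Laplacian $\operatorname{Lap}$ of a graph is the $n\times n$ matrix with the degrees of that graph on the diagonal, $-1$ in entry $(i,j)$ if $i,j$ are adjacent, and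 $0$ otherwise. The degree balance of $G$ is $\boldsymbol\delta=(\delta_1,\ldots,\delta_n)$, $\delta_i=d_i^{\rm out}-d_i^{\rm in}$. Kronecker notation: for $K\in\mathbb R^{m\times p}$, $K_\otimes=K\otimes\mathrm{Id}_{\mathcal H}:\mathcal H^p\to\mathcal H^m$, $(K_\otimes\boldsymbol x)_i=\sum_jK_{i,j}x_j$; for a column vector $\boldsymbol\beta\in\mathbb R^m$, $\boldsymbol\beta_\otimes x=(\beta_1x,\ldots,\beta_mx)$. $\mathbf 1_n\in\mathbb R^n$ is the all-ones vector and $I_{n-1}$ the identity matrix of order $n-1$. Operators: $\mathcal A_n(x)=A_1(x)\times\cdots\times A_n(x)$ for $x\in\mathcal H$; $\mathcal A_D(\boldsymbol x)=A_1(x_1)\times\cdots\times A_n(x_n)$ for $\boldsymbol x\in\mathcal H^n$. $P(G)\in\mathbb R^{n\times n}$ has entries $P(G)_{i,i}=d_i$, $P(G)_{i,j}=-2$ if $(j,i)\in\mathcal E$, and $0$ otherwise. Define $\mathcal M:\mathcal H^{2n-1}\to\mathcal H^{2n-1}$, $\mathcal C:\mathcal H^{n-1}\to\mathcal H^{2n-1}$ and $\mathcal A:\mathcal H^{2n-1}\rightrightarrows\mathcal H^{2n-1}$ (with $\mathcal H^{2n-1}=\mathcal H^n\times\mathcal H^{n-1}$) by $$\mathcal M=\begin{bmatrix}\operatorname{Lap}(G') & Z \\ Z^* & I_{n-1}\end{bmatrix}_\otimes,\quad \mathcal C=\begin{bmatrix} Z \\ I_{n-1}\end{bmatrix}_\otimes,\quad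 \mathcal A=\begin{bmatrix}\mathcal A_D+P(G)_\otimes-\operatorname{Lap}(G')_\otimes & -Z_\otimes \\ Z^*_\otimes & 0\end{bmatrix}.$$ $(\mathcal M+\mathcal A)^{-1}$ is the inverse as a set-valued operator (it is single-valued with full domain), and $\mathcal T=(\mathcal M+\mathcal A)^{-1}\mathcal M:\mathcal H^{2n-1}\to\mathcal H^{2n-1}$, $\widetilde{\mathcal T}=\mathcal C^*(\mathcal M+\mathcal A)^{-1}\mathcal C:\mathcal H^{n-1}\to\mathcal H^{n-1}$.
   Formalization: The final claim (unique solution x_v given by the resolvent, lying in the zeros of the sum) is stated only for v in the fixed-point set of the reduced operator, i.e. v for which the inclusion is solvable; for all v it is false (H=R, n=2, A_1=A_2=Id, v≠0). *)

theory Defs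
  imports "HOL-Analysis.Analysis"
begin

text \<open>
  The Hilbert space is a type \<open>'a :: {real_inner, complete_space}\<close>, and \<open>'a ^ 'm\<close> with the
  library's inner product is its Hilbert power. The node set {1,...,n} is a finite linearly ordered
  type \<open>'n\<close>; node 1 is its least element. The number n - 1 is the cardinality of an auxiliary
  finite type \<open>'m\<close>, with \<open>CARD('n) = CARD('m) + 1\<close> assumed where it matters.
\<close>

subsection \<open>Set-valued operators\<close>

text \<open>Sums of sets, written with plus and \<open>\<Sum>\<close>, are Minkowski sums (\<open>HOL-Library.Set_Algebras\<close>).\<close>

definition op_graph :: "('a \<Rightarrow> 'b set) \<Rightarrow> ('a \<times> 'b) set" where
  "op_graph A = {(x, u). u \<in> A x}"

definition monotone_op :: "('a::real_inner \<Rightarrow> 'a set) \<Rightarrow> bool" where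
  "monotone_op A \<longleftrightarrow> (\<forall>x y u v. u \<in> A x \<longrightarrow> v \<in> A y \<longrightarrow> inner (x - y) (u - v) \<ge> 0)"

definition maximally_monotone :: "('a::real_inner \<Rightarrow> 'a set) \<Rightarrow> bool" where
  "maximally_monotone A \<longleftrightarrow>
     monotone_op A \<and> \<not> (\<exists>B. monotone_op B \<and> op_graph A \<subset> op_graph B)"

definition zer :: "('a \<Rightarrow> 'b::zero set) \<Rightarrow> 'a set" where
  "zer A = {x. 0 \<in> A x}"

definition op_inverse :: "('a \<Rightarrow> 'b set) \<Rightarrow> 'b \<Rightarrow> 'a set" where
  "op_inverse A y = {x. y \<in> A x}"

text \<open>The resolvent is kept set-valued: \<open>J x = y\<close> reads \<open>resolvent A x = {y}\<close>.\<close>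

definition resolvent :: "('a::real_inner \<Rightarrow> 'a set) \<Rightarrow> 'a \<Rightarrow> 'a set" where
  "resolvent A = op_inverse (\<lambda>x. {x} + A x)"

definition op_scale :: "real \<Rightarrow> ('a \<Rightarrow> 'b::real_vector set) \<Rightarrow> 'a \<Rightarrow> 'b set" where
  "op_scale c A x = (\<lambda>u. c *\<^sub>R u) ` A x"

text \<open>A single-valued operator is one with singleton values, so that \<open>T(x) = x\<close> for such an
  operator reads \<open>T x = {x}\<close>; this is stronger than \<open>x \<in> T x\<close>.\<close>

definition Fix :: "('a \<Rightarrow> 'a set) \<Rightarrow> 'a set" where
  "Fix T = {x. T x = {x}}"


subsection \<open>Graphs\<close>

definition in_degree :: "('n \<times> 'n) set \<Rightarrow> 'n \<Rightarrow> nat" where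
  "in_degree E i = card {j. (j, i) \<in> E}"

definition out_degree :: "('n \<times> 'n) set \<Rightarrow> 'n \<Rightarrow> nat" where
  "out_degree E i = card {j. (i, j) \<in> E}"

definition node_degree :: "('n \<times> 'n) set \<Rightarrow> 'n \<Rightarrow> nat" where
  "node_degree E i = in_degree E i + out_degree E i"

definition graph_connected :: "('n \<times> 'n) set \<Rightarrow> bool" where
  "graph_connected E \<longleftrightarrow> (\<forall>i j. (i, j) \<in> (E \<union> E\<inverse>)\<^sup>*)"

definition algorithmic_graph :: "('n::{finite,linorder} \<times> 'n) set \<Rightarrow> bool" where
  "algorithmic_graph E \<longleftrightarrow>
     CARD('n) \<ge> 2 \<and> (\<forall>i j. (i, j) \<in> E \<longrightarrow> i < j) \<and> graph_connected E"

definition Lap :: "('n::finite \<times> 'n) set \<Rightarrow> real^'n^'n" where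
  "Lap E = (\<chi> i j. if i = j then real (node_degree E i)
                   else if (i, j) \<in> E \<or> (j, i) \<in> E then -1 else 0)"

definition degree_balance :: "('n::finite \<times> 'n) set \<Rightarrow> real^'n" where
  "degree_balance E = (\<chi> i. real (out_degree E i) - real (in_degree E i))"

definition P_mat :: "('n::finite \<times> 'n) set \<Rightarrow> real^'n^'n" where
  "P_mat E = (\<chi> i j. if i = j then real (node_degree E i)
                     else if (j, i) \<in> E then -2 else 0)"

definition onto_decomposition :: "real^'m^'n \<Rightarrow> ('n::finite \<times> 'n) set \<Rightarrow> bool" where
  "onto_decomposition Z E \<longleftrightarrow> CARD('n) = CARD('m::finite) + 1 \<and> Lap E = Z ** transpose Z"


subsection \<open>Kronecker products with the identity\<close>

definition kron :: "real^'p^'m \<Rightarrow> ('a::real_vector)^'p \<Rightarrow> 'a^'m" where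
  "kron K x = (\<chi> i. \<Sum>j\<in>UNIV. K $ i $ j *\<^sub>R x $ j)"

definition kron_vec :: "real^'m \<Rightarrow> 'a::real_vector \<Rightarrow> 'a^'m" where
  "kron_vec b x = (\<chi> i. b $ i *\<^sub>R x)"


subsection \<open>The block operators\<close>

definition op_An :: "('n::finite \<Rightarrow> 'a \<Rightarrow> 'a set) \<Rightarrow> 'a \<Rightarrow> ('a^'n) set" where
  "op_An A x = {u. \<forall>i. u $ i \<in> A i x}"

definition op_AD :: "('n::finite \<Rightarrow> 'a \<Rightarrow> 'a set) \<Rightarrow> 'a^'n \<Rightarrow> ('a^'n) set" where
  "op_AD A x = {u. \<forall>i. u $ i \<in> A i (x $ i)}"

definition op_M ::
  "('n::finite \<times> 'n) set \<Rightarrow> real^'m^'n \<Rightarrow> (('a::real_inner)^'n) \<times> ('a^'m) \<Rightarrow> ('a^'n) \<times> ('a^'m)" where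
  "op_M E' Z = (\<lambda>(x, v). (kron (Lap E') x + kron Z v, kron (transpose Z) x + kron (mat 1) v))"

definition op_C :: "real^'m^'n \<Rightarrow> ('a::real_inner)^'m \<Rightarrow> ('a^'n) \<times> ('a^'m)" where
  "op_C Z v = (kron Z v, kron (mat 1) v)"

definition op_A ::
  "('n::finite \<Rightarrow> 'a \<Rightarrow> 'a set) \<Rightarrow> ('n \<times> 'n) set \<Rightarrow> ('n \<times> 'n) set \<Rightarrow> real^'m^'n \<Rightarrow>
     (('a::real_inner)^'n) \<times> ('a^'m) \<Rightarrow> (('a^'n) \<times> ('a^'m)) set" where
  "op_A A E E' Z = (\<lambda>(x, v).
     (op_AD A x + {kron (P_mat E) x - kron (Lap E') x - kron Z v}) \<times> {kron (transpose Z) x})"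

definition op_T ::
  "('n::finite \<Rightarrow> 'a \<Rightarrow> 'a set) \<Rightarrow> ('n \<times> 'n) set \<Rightarrow> ('n \<times> 'n) set \<Rightarrow> real^'m^'n \<Rightarrow>
     (('a::real_inner)^'n) \<times> ('a^'m) \<Rightarrow> (('a^'n) \<times> ('a^'m)) set" where
  "op_T A E E' Z z = op_inverse (\<lambda>w. {op_M E' Z w} + op_A A E E' Z w) (op_M E' Z z)"

definition op_T_reduced ::
  "('n::finite \<Rightarrow> 'a \<Rightarrow> 'a set) \<Rightarrow> ('n \<times> 'n) set \<Rightarrow> ('n \<times> 'n) set \<Rightarrow> real^'m^'n \<Rightarrow>
     ('a::real_inner)^'m \<Rightarrow> ('a^'m) set" where
  "op_T_reduced A E E' Z v =
     adjoint (op_C Z) ` op_inverse (\<lambda>w. {op_M E' Z w} + op_A A E E' Z w) (op_C Z v)"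

end

theory Submission
  imports Defs
begin

text \<open>
  In the sum \<open>\<M> + \<A>\<close> the blocks \<open>Lap E'\<close> and \<open>Z\<close> of the first row cancel, so that \<open>(x, v)\<close> lies in
  \<open>(\<M> + \<A>)\<inverse> (y, w)\<close> exactly when \<open>y \<in> A\<^sub>D x + P x\<close> and \<open>w = 2 Z\<^sup>* x + v\<close> (lemma
  \<open>mem_inverse_M_plus_A_iff\<close>). As edges go from smaller to larger nodes, \<open>P\<close> is lower triangular with
  the positive degrees on its diagonal; monotonicity therefore determines the components of \<open>x\<close> from
  \<open>y\<close> one after the other (\<open>op_AD_P_mat_inj\<close>). Hence \<open>(\<M> + \<A>)\<inverse>\<close> has at most one value at each
  point, and a point is fixed by \<open>\<T>\<close>, or by the reduced operator, as soon as it is an element of its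
  own image.

  Written out, either membership amounts to the same system: \<open>Z\<^sup>* x = 0\<close> and \<open>Z v \<in> A\<^sub>D x + P x\<close>. For
  \<open>\<T>\<close> the second row reads \<open>Z\<^sup>* x + v = 2 Z\<^sup>* x + v\<close>, and then \<open>Lap E' x = Z Z\<^sup>* x\<close> disappears from the
  first; for the reduced operator, the rows \<open>v = 2 Z\<^sup>* x + w\<close> and \<open>v = Z\<^sup>* x + w\<close> are compared.
  The quadratic form of a Laplacian is the sum of the squared differences over the edges
  (\<open>inner_kron_Lap\<close>), so for a connected graph \<open>E'\<close> the condition \<open>Z\<^sup>* x = 0\<close> says that \<open>x\<close> is a
  constant vector \<open>\<one> \<xi>\<close> (\<open>kron_transpose_decomposition_eq_0_iff\<close>). On constant vectors \<open>P\<close> acts as the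
  degree balance, because \<open>d\<^sub>i - 2 d\<^sub>i\<^sup>i\<^sup>n = \<delta>\<^sub>i\<close> (\<open>kron_P_mat_constant\<close>). This gives both sets of fixed points.

  The first node has no incoming edge, so its component of the inclusion \<open>Z v \<in> A\<^sub>n \<xi> + \<delta> \<xi>\<close> is
  \<open>(Z v)\<^sub>1 - d\<^sub>1 \<xi> \<in> A\<^sub>1 \<xi>\<close>, which is the resolvent equation and has at most one solution. Adding up
  the components over all nodes gives a zero of the sum: the entries of \<open>Z v\<close> add up to \<open>0\<close> because \<open>Z\<^sup>*\<close>
  annihilates constants, and the entries of \<open>\<delta>\<close> because every edge has one tail and one head.
\<close>

section \<open>Matrices acting on powers of a vector space\<close>

lemma kron_nth: "kron K x $ i = (\<Sum>j\<in>UNIV. K $ i $ j *\<^sub>R x $ j)"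
  by (simp add: kron_def)

lemma kron_zero: "kron K 0 = 0"
  by (simp add: kron_def vec_eq_iff)

lemma kron_mat_1: "kron (mat 1) v = v"
  by (simp add: vec_eq_iff kron_nth mat_def if_distrib[of "\<lambda>c. c *\<^sub>R _"] cong: if_cong)

lemma kron_compose: "kron K (kron L x) = kron (K ** L) x"
proof -
  have "(\<Sum>j\<in>UNIV. K $ i $ j *\<^sub>R (\<Sum>k\<in>UNIV. L $ j $ k *\<^sub>R x $ k)) =
        (\<Sum>k\<in>UNIV. (\<Sum>j\<in>UNIV. K $ i $ j * L $ j $ k) *\<^sub>R x $ k)" for i
    by (simp add: scaleR_sum_left scaleR_sum_right) (rule sum.swap)
  then show ?thesis
    by (simp add: vec_eq_iff kron_nth matrix_matrix_mult_def)
qed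

lemma inner_kron_transpose:
  fixes x :: "'a::real_inner^'p"
  shows "inner (kron K x) y = inner x (kron (transpose K) y)"
proof -
  have "(\<Sum>i\<in>UNIV. \<Sum>j\<in>UNIV. K $ i $ j * inner (x $ j) (y $ i)) =
        (\<Sum>j\<in>UNIV. \<Sum>i\<in>UNIV. K $ i $ j * inner (x $ j) (y $ i))"
    by (rule sum.swap)
  then show ?thesis
    by (simp add: inner_vec_def kron_nth inner_sum_left inner_sum_right transpose_def)
qed

section \<open>The kernel of a graph Laplacian\<close>

text \<open>
  Edges that respect a strict order exclude loops and pairs of opposite edges. Without this, an entry
  \<open>-1\<close> could stand for two edges, or the diagonal count a loop, and row \<open>i\<close> would not split into the
  contributions of the individual edges at \<open>i\<close>.
\<close>

lemma kron_Lap_nth: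
  fixes x :: "'a::real_vector^'n::{finite,linorder}"
  assumes ord: "\<And>i j. (i, j) \<in> E \<Longrightarrow> i < j"
  shows "kron (Lap E) x $ i =
           (\<Sum>j | (i, j) \<in> E. x $ i - x $ j) + (\<Sum>j | (j, i) \<in> E. x $ i - x $ j)"
proof -
  have entry: "Lap E $ i $ j *\<^sub>R x $ j =
      (if j = i then real (node_degree E i) *\<^sub>R x $ i else 0)
      - (if (i, j) \<in> E then x $ j else 0) - (if (j, i) \<in> E then x $ j else 0)" for j
    using ord[of i j] ord[of j i] by (auto simp: Lap_def)
  have "kron (Lap E) x $ i =
      real (node_degree E i) *\<^sub>R x $ i - (\<Sum>j | (i, j) \<in> E. x $ j) - (\<Sum>j | (j, i) \<in> E. x $ j)"
    by (simp add: kron_nth entry sum_subtractf sum.inter_filter[symmetric])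
  then show ?thesis
    by (simp add: sum_subtractf node_degree_def in_degree_def out_degree_def
        sum_constant_scaleR scaleR_add_left)
qed

lemma sum_out_edges:
  fixes E :: "('n::finite \<times> 'n) set"
  shows "(\<Sum>i\<in>UNIV. \<Sum>j | (i, j) \<in> E. f i j) = (\<Sum>(i, j)\<in>E. f i j)"
  by (subst sum.Sigma) (auto intro!: sum.cong)

lemma sum_in_edges:
  fixes E :: "('n::finite \<times> 'n) set"
  shows "(\<Sum>i\<in>UNIV. \<Sum>j | (j, i) \<in> E. f i j) = (\<Sum>(i, j)\<in>E. f j i)"
proof -
  have "(\<Sum>i\<in>UNIV. \<Sum>j | (j, i) \<in> E. f i j) = (\<Sum>(j, i)\<in>E\<inverse>. f j i)"
    using sum_out_edges[of f "E\<inverse>"] by simp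
  also have "\<dots> = (\<Sum>(i, j)\<in>E. f j i)"
    by (rule sum.reindex_bij_witness[where i = prod.swap and j = prod.swap]) auto
  finally show ?thesis .
qed

text \<open>
  An edge \<open>(i, j)\<close> contributes \<open>\<langle>x\<^sub>i, x\<^sub>i - x\<^sub>j\<rangle>\<close> in row \<open>i\<close> and \<open>\<langle>x\<^sub>j, x\<^sub>j - x\<^sub>i\<rangle>\<close> in row \<open>j\<close>; the two
  together make a square.
\<close>

lemma inner_kron_Lap:
  fixes x :: "'a::real_inner^'n::{finite,linorder}"
  assumes ord: "\<And>i j. (i, j) \<in> E \<Longrightarrow> i < j"
  shows "inner x (kron (Lap E) x) = (\<Sum>(i, j)\<in>E. (norm (x $ i - x $ j))\<^sup>2)"
proof -
  have "inner x (kron (Lap E) x) =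
      (\<Sum>(i, j)\<in>E. inner (x $ i) (x $ i - x $ j)) + (\<Sum>(i, j)\<in>E. inner (x $ j) (x $ j - x $ i))"
    by (simp add: inner_vec_def kron_Lap_nth[OF ord] inner_add_right inner_sum_right
        sum.distrib sum_out_edges sum_in_edges)
  also have "\<dots> = (\<Sum>(i, j)\<in>E. (norm (x $ i - x $ j))\<^sup>2)"
    unfolding sum.distrib[symmetric]
    by (intro sum.cong) (auto simp: power2_norm_eq_inner inner_diff inner_commute)
  finally show ?thesis .
qed

text \<open>
  If the quadratic form vanishes, \<open>x\<close> takes the same value at both ends of every edge, hence along every
  path.
\<close>

lemma kron_Lap_eq_0_iff:
  fixes x :: "'a::real_inner^'n::{finite,linorder}"
  assumes ord: "\<And>i j. (i, j) \<in> E \<Longrightarrow> i < j" and conn: "graph_connected E"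
  shows "kron (Lap E) x = 0 \<longleftrightarrow> (\<exists>\<xi>. x = kron_vec 1 \<xi>)"
proof
  assume "kron (Lap E) x = 0"
  then have "(\<Sum>(i, j)\<in>E. (norm (x $ i - x $ j))\<^sup>2) = 0"
    using inner_kron_Lap[OF ord, of E x] by simp
  then have edge: "x $ i = x $ j" if "(i, j) \<in> E" for i j
    using that by (subst (asm) sum_nonneg_eq_0_iff) auto
  have const: "x $ i = x $ j" for i j
  proof -
    have "(i, j) \<in> (E \<union> E\<inverse>)\<^sup>*"
      using conn by (simp add: graph_connected_def)
    then show ?thesis
      by induction (auto dest: edge)
  qed
  have "x = kron_vec 1 (x $ undefined)"
    unfolding vec_eq_iff kron_vec_def using const by simp
  then show "\<exists>\<xi>. x = kron_vec 1 \<xi>" ..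
next
  assume "\<exists>\<xi>. x = kron_vec 1 \<xi>"
  then show "kron (Lap E) x = 0"
    by (auto simp: vec_eq_iff kron_Lap_nth[OF ord] kron_vec_def)
qed

text \<open>
  \<open>Z\<^sup>*\<close> and \<open>Z Z\<^sup>*\<close> have the same kernel, since \<open>\<langle>x, Z Z\<^sup>* x\<rangle>\<close> is the squared norm of \<open>Z\<^sup>* x\<close>.
\<close>

lemma kron_transpose_decomposition_eq_0_iff:
  fixes x :: "'a::real_inner^'n::{finite,linorder}" and Z :: "real^'m^'n::{finite,linorder}"
  assumes ord: "\<And>i j. (i, j) \<in> E \<Longrightarrow> i < j" and conn: "graph_connected E"
    and dec: "Lap E = Z ** transpose Z"
  shows "kron (transpose Z) x = 0 \<longleftrightarrow> (\<exists>\<xi>. x = kron_vec 1 \<xi>)"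
proof -
  have "kron (transpose Z) x = 0 \<longleftrightarrow> kron (Lap E) x = 0"
  proof
    assume "kron (Lap E) x = 0"
    then have "inner x (kron Z (kron (transpose Z) x)) = 0"
      by (simp add: dec kron_compose)
    then show "kron (transpose Z) x = 0"
      using inner_kron_transpose[of "transpose Z" x "kron (transpose Z) x"]
      by (simp add: transpose_transpose)
  qed (simp add: dec kron_compose[symmetric] kron_zero)
  then show ?thesis
    using kron_Lap_eq_0_iff[OF ord conn] by simp
qed

text \<open>
  The sum of the components is tested against a vector \<open>h\<close>: this is the inner product of \<open>Z v\<close> with
  the constant vector \<open>\<one> h\<close>, which lies in the kernel of \<open>Z\<^sup>*\<close>.
\<close>

lemma sum_kron_decomposition:
  fixes v :: "'a::real_inner^'m" and Z :: "real^'m^'n::{finite,linorder}"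
  assumes ord: "\<And>i j. (i, j) \<in> E \<Longrightarrow> i < j" and conn: "graph_connected E"
    and dec: "Lap E = Z ** transpose Z"
  shows "(\<Sum>i\<in>UNIV. kron Z v $ i) = 0"
proof -
  have "inner (\<Sum>i\<in>UNIV. kron Z v $ i) h = 0" for h
  proof -
    have "kron (transpose Z) (kron_vec 1 h) = 0"
      by (subst kron_transpose_decomposition_eq_0_iff[OF ord conn dec]) auto
    then have "inner (kron Z v) (kron_vec 1 h) = 0"
      by (simp add: inner_kron_transpose)
    then show ?thesis
      by (simp add: inner_vec_def kron_vec_def inner_sum_left)
  qed
  from this[of "\<Sum>i\<in>UNIV. kron Z v $ i"] show ?thesis
    by simp
qed

section \<open>Node degrees and the matrix P\<close>

text \<open>
  A path from \<open>i\<close> to any other node starts with an edge at \<open>i\<close>.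
\<close>

lemma node_degree_pos:
  assumes "graph_connected E" and "CARD('n::finite) \<ge> 2"
  shows "node_degree E (i::'n) > 0"
proof -
  have "\<exists>j. j \<noteq> i"
  proof (rule ccontr)
    assume "\<nexists>j. j \<noteq> i"
    then have "UNIV = {i}" by auto
    then have "CARD('n) = 1" by (metis card_1_singleton_iff One_nat_def)
    then show False using assms(2) by simp
  qed
  then obtain j where "j \<noteq> i" ..
  moreover have "(i, j) \<in> (E \<union> E\<inverse>)\<^sup>*"
    using assms(1) by (simp add: graph_connected_def)
  ultimately obtain k where "(i, k) \<in> E \<or> (k, i) \<in> E"
    by (metis (no_types, lifting) UnE converseD converse_rtranclE)
  then show ?thesis
    by (auto simp: node_degree_def in_degree_def out_degree_def card_gt_0_iff)
qed

lemma in_degree_Min: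
  assumes ord: "\<And>i j. (i, j) \<in> E \<Longrightarrow> i < j"
  shows "in_degree E (Min (UNIV :: 'n::{finite,linorder} set)) = 0"
proof -
  have "(j, Min UNIV) \<notin> E" for j
    using ord[of j "Min UNIV"] Min_le[OF finite UNIV_I, of j] by (auto simp del: Min_le)
  then show ?thesis
    by (simp add: in_degree_def)
qed

lemma sum_degree_balance: "(\<Sum>i\<in>UNIV. degree_balance E $ i) = 0"
  using sum_out_edges[of "\<lambda>_ _. 1 :: real" E] sum_in_edges[of "\<lambda>_ _. 1 :: real" E]
  by (simp add: degree_balance_def out_degree_def in_degree_def sum_subtractf)

lemma kron_P_mat_nth:
  fixes x :: "'a::real_vector^'n::{finite,linorder}"
  assumes ord: "\<And>i j. (i, j) \<in> E \<Longrightarrow> i < j"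
  shows "kron (P_mat E) x $ i = real (node_degree E i) *\<^sub>R x $ i - 2 *\<^sub>R (\<Sum>j | (j, i) \<in> E. x $ j)"
proof -
  have entry: "P_mat E $ i $ j *\<^sub>R x $ j =
      (if j = i then real (node_degree E i) *\<^sub>R x $ i else 0)
      - (if (j, i) \<in> E then 2 *\<^sub>R x $ j else 0)" for j
    using ord[of j i] by (auto simp: P_mat_def)
  show ?thesis
    by (simp add: kron_nth entry sum_subtractf sum.inter_filter[symmetric] scaleR_sum_right)
qed

lemma kron_P_mat_constant:
  fixes \<xi> :: "'a::real_vector" and E :: "('n::{finite,linorder} \<times> 'n) set"
  assumes ord: "\<And>i j. (i, j) \<in> E \<Longrightarrow> i < j"
  shows "kron (P_mat E) (kron_vec 1 \<xi>) = kron_vec (degree_balance E) \<xi>"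
  by (simp add: vec_eq_iff kron_P_mat_nth[OF ord] kron_vec_def sum_constant_scaleR
      degree_balance_def node_degree_def in_degree_def scaleR_diff_left[symmetric])

section \<open>Uniqueness from monotonicity\<close>

text \<open>
  The hypothesis gives \<open>u - v = - c (x - y)\<close>, whose inner product with \<open>x - y\<close> is
  \<open>- c \<parallel>x - y\<parallel>\<^sup>2\<close>, whereas monotonicity makes it nonnegative.
\<close>

lemma monotone_op_add_scaleR_inj:
  assumes mono: "monotone_op A" and c: "c > 0" and "u \<in> A x" "v \<in> A y"
    and eq: "u + c *\<^sub>R x = v + c *\<^sub>R y"
  shows "x = y"
proof -
  have "u - v = - c *\<^sub>R (x - y)"
    using eq by (simp add: algebra_simps)
  moreover have "inner (x - y) (u - v) \<ge> 0"
    using assms by (simp add: monotone_op_def)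
  ultimately have "c * (norm (x - y))\<^sup>2 \<le> 0"
    by (simp add: power2_norm_eq_inner)
  then show ?thesis
    using c by (simp add: mult_le_0_iff)
qed

text \<open>
  Forward substitution: by the order of the nodes, row \<open>i\<close> of \<open>P\<close> involves only \<open>x\<^sub>i\<close>, with the
  positive coefficient \<open>d\<^sub>i\<close>, and components of smaller index, which agree by induction.
\<close>

lemma op_AD_P_mat_inj:
  fixes x y :: "'a::real_inner^'n::{finite,linorder}"
  assumes mono: "\<And>i. monotone_op (A i)"
    and ord: "\<And>i j. (i, j) \<in> E \<Longrightarrow> i < j"
    and pos: "\<And>i. node_degree E i > 0"
    and "u \<in> op_AD A x" "v \<in> op_AD A y"
    and eq: "u + kron (P_mat E) x = v + kron (P_mat E) y"
  shows "x = y"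
proof -
  have "x $ i = y $ i" for i
    \<comment> \<open>The order on nodes is well-founded by finiteness; counting the smaller nodes makes this explicit.\<close>
  proof (induction i rule: measure_induct_rule[where f = "\<lambda>i. card {..<i}"])
    case (less i)
    have "x $ j = y $ j" if "(j, i) \<in> E" for j
    proof (rule less)
      have "{..<j} \<subset> {..<i}"
        using ord[OF that] by (metis lessThan_strict_subset_iff)
      then show "card {..<j} < card {..<i}"
        by (rule psubset_card_mono[OF finite])
    qed
    then have "(\<Sum>j | (j, i) \<in> E. x $ j) = (\<Sum>j | (j, i) \<in> E. y $ j)"
      by (intro sum.cong) auto
    moreover have "(u + kron (P_mat E) x) $ i = (v + kron (P_mat E) y) $ i"
      using eq by simp
    ultimately have "u $ i + real (node_degree E i) *\<^sub>R x $ i = v $ i + real (node_degree E i) *\<^sub>R y $ i"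
      by (simp add: kron_P_mat_nth[OF ord])
    moreover have "u $ i \<in> A i (x $ i)" "v $ i \<in> A i (y $ i)"
      using assms(4,5) by (simp_all add: op_AD_def)
    moreover have "real (node_degree E i) > 0"
      using pos by simp
    ultimately show ?case
      using monotone_op_add_scaleR_inj[OF mono] by blast
  qed
  then show ?thesis
    by (simp add: vec_eq_iff)
qed

lemma mem_resolvent_op_scale_iff:
  assumes "c > 0"
  shows "x \<in> resolvent (op_scale (1 / c) A) ((1 / c) *\<^sub>R y) \<longleftrightarrow> y - c *\<^sub>R x \<in> A x"
proof -
  have "(1 / c) *\<^sub>R y = x + (1 / c) *\<^sub>R u \<longleftrightarrow> u = y - c *\<^sub>R x" for u
  proof -
    have "x + (1 / c) *\<^sub>R u = (1 / c) *\<^sub>R (c *\<^sub>R x + u)"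
      using assms by (simp add: scaleR_add_right)
    then show ?thesis
      using assms by (auto simp del: scaleR_add_right)
  qed
  then show ?thesis
    by (auto simp: resolvent_def op_inverse_def op_scale_def set_plus_def)
qed

section \<open>The block operators\<close>

text \<open>
  Adding \<open>\<M>\<close> to \<open>\<A>\<close> cancels \<open>Lap E'\<close> and \<open>Z\<close> in the first row and doubles \<open>Z\<^sup>*\<close> in the second.
  What remains is block triangular: \<open>x\<close> depends on \<open>y\<close> alone, and then \<open>v\<close> is explicit.
\<close>

lemma mem_inverse_M_plus_A_iff:
  "(x, v) \<in> op_inverse (\<lambda>w. {op_M E' Z w} + op_A A E E' Z w) (y, w) \<longleftrightarrow>
     (\<exists>u\<in>op_AD A x. y = u + kron (P_mat E) x) \<and> w = 2 *\<^sub>R kron (transpose Z) x + v"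
proof -
  let ?a = "\<lambda>u. (u + (kron (P_mat E) x - kron (Lap E') x - kron Z v), kron (transpose Z) x)"
  have "op_A A E E' Z (x, v) = ?a ` op_AD A x"
    by (auto simp: op_A_def set_plus_def)
  then have "{op_M E' Z (x, v)} + op_A A E E' Z (x, v) = (\<lambda>u. op_M E' Z (x, v) + ?a u) ` op_AD A x"
    by (auto simp: set_plus_def)
  moreover have "op_M E' Z (x, v) + ?a u = (u + kron (P_mat E) x, 2 *\<^sub>R kron (transpose Z) x + v)" for u
    by (simp add: op_M_def kron_mat_1 scaleR_2)
  ultimately show ?thesis
    by (auto simp: op_inverse_def)
qed

lemma adjoint_op_C:
  fixes Z :: "real^'m^'n"
  shows "adjoint (op_C Z) = (\<lambda>(x::'a::real_inner^'n, v). kron (transpose Z) x + v)"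
  by (rule adjoint_unique)
     (auto simp: op_C_def kron_mat_1 inner_kron_transpose inner_add_right)

text \<open>
  For operators with at most one value at each point, this reduces the condition \<open>T x = {x}\<close> in the
  definition of fixed points to \<open>x \<in> T x\<close>.
\<close>

lemma singleton_eq_iff_mem:
  assumes "\<And>a b. a \<in> S \<Longrightarrow> b \<in> S \<Longrightarrow> a = b"
  shows "S = {x} \<longleftrightarrow> x \<in> S"
  using assms by auto

text \<open>
  The product of the sets \<open>A\<^sub>i \<xi>\<close> is the diagonal operator at a constant vector; in this form the
  inclusion can be compared with the first row of \<open>\<M> + \<A>\<close>.
\<close>

lemma inclusion_iff:
  "y \<in> op_An A x + {kron_vec b x} \<longleftrightarrow> (\<exists>u\<in>op_AD A (kron_vec 1 x). y = u + kron_vec b x)"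
  by (auto simp: set_plus_def op_An_def op_AD_def kron_vec_def)

section \<open>Fixed points of the two operators\<close>

theorem lemma3p7:
  fixes A :: "'n::{finite,linorder} \<Rightarrow> 'a::{real_inner,complete_space} \<Rightarrow> 'a set"
    and E E' :: "('n \<times> 'n) set"
    and Z :: "real^'m^'n::{finite,linorder}"
  assumes "\<And>i. maximally_monotone (A i)"
    and "zer (\<lambda>x. \<Sum>i\<in>UNIV. A i x) \<noteq> {}"
    and "algorithmic_graph E"
    and "E' \<subseteq> E" and "graph_connected E'"
    and "onto_decomposition Z E'"
  shows "Fix (op_T A E E' Z) =
           {(kron_vec 1 x, v) | x v. kron Z v \<in> op_An A x + {kron_vec (degree_balance E) x}}
       \<and> Fix (op_T_reduced A E E' Z) =
           {v. \<exists>x. kron Z v \<in> op_An A x + {kron_vec (degree_balance E) x}}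
       \<and> (\<forall>v \<in> Fix (op_T_reduced A E E' Z). \<exists>x_v.
            {x. kron Z v \<in> op_An A x + {kron_vec (degree_balance E) x}} = {x_v}
          \<and> (let i1 = Min (UNIV :: 'n set); d1 = real (node_degree E i1) in
               resolvent (op_scale (1 / d1) (A i1)) ((1 / d1) *\<^sub>R (kron Z v $ i1)) = {x_v})
          \<and> x_v \<in> zer (\<lambda>x. \<Sum>i\<in>UNIV. A i x))"
proof -
  have mono: "monotone_op (A i)" for i
    using assms(1) by (simp add: maximally_monotone_def)
  have ord: "i < j" if "(i, j) \<in> E" for i j
    using assms(3) that by (simp add: algorithmic_graph_def)
  have ord': "i < j" if "(i, j) \<in> E'" for i j
    using assms(4) that ord by blast
  have pos: "node_degree E i > 0" for i
    using assms(3) by (simp add: algorithmic_graph_def node_degree_pos)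
  have dec: "Lap E' = Z ** transpose Z"
    using assms(6) by (simp add: onto_decomposition_def)
  have ker: "kron (transpose Z) x = 0 \<longleftrightarrow> (\<exists>\<xi>. x = kron_vec 1 \<xi>)" for x :: "'a^'n::{finite,linorder}"
    by (rule kron_transpose_decomposition_eq_0_iff[OF _ assms(5) dec]) (rule ord')
  let ?R = "op_inverse (\<lambda>w. {op_M E' Z w} + op_A A E E' Z w)"
  let ?incl = "\<lambda>v x. kron Z v \<in> op_An A x + {kron_vec (degree_balance E) x}"
  have incl: "?incl v x \<longleftrightarrow>
      (\<exists>u\<in>op_AD A (kron_vec 1 x). kron Z v = u + kron (P_mat E) (kron_vec 1 x))" for v x
    by (simp add: inclusion_iff kron_P_mat_constant[OF ord])
  have single: "p = q" if "p \<in> ?R z" "q \<in> ?R z" for p q z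
  proof -
    obtain x v x' v' y w where [simp]: "p = (x, v)" "q = (x', v')" "z = (y, w)"
      by (metis surj_pair)
    have "x = x'"
      using that by (auto simp: mem_inverse_M_plus_A_iff intro: op_AD_P_mat_inj[OF mono ord pos])
    then show ?thesis
      using that by (simp add: mem_inverse_M_plus_A_iff)
  qed

  have fix_T: "(x, v) \<in> Fix (op_T A E E' Z) \<longleftrightarrow> (\<exists>\<xi>. x = kron_vec 1 \<xi> \<and> ?incl v \<xi>)" for x v
  proof -
    have M: "op_M E' Z (x, v) = (kron (Lap E') x + kron Z v, kron (transpose Z) x + v)"
      by (simp add: op_M_def kron_mat_1)
    have "(x, v) \<in> Fix (op_T A E E' Z) \<longleftrightarrow> (x, v) \<in> ?R (op_M E' Z (x, v))"
      by (simp add: Fix_def op_T_def singleton_eq_iff_mem single)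
    also have "\<dots> \<longleftrightarrow> kron (transpose Z) x = 0 \<and>
        (\<exists>u\<in>op_AD A x. kron (Lap E') x + kron Z v = u + kron (P_mat E) x)"
      unfolding M mem_inverse_M_plus_A_iff by (auto simp: scaleR_2)
    \<comment> \<open>\<open>Lap E' x = Z Z\<^sup>* x\<close> vanishes once \<open>Z\<^sup>* x\<close> does.\<close>
    also have "\<dots> \<longleftrightarrow> kron (transpose Z) x = 0 \<and>
        (\<exists>u\<in>op_AD A x. kron Z v = u + kron (P_mat E) x)"
      by (auto simp: dec kron_compose[symmetric] kron_zero)
    also have "\<dots> \<longleftrightarrow> (\<exists>\<xi>. x = kron_vec 1 \<xi> \<and> ?incl v \<xi>)"
      unfolding ker incl by auto
    finally show ?thesis .
  qed

  have fix_reduced: "v \<in> Fix (op_T_reduced A E E' Z) \<longleftrightarrow> (\<exists>\<xi>. ?incl v \<xi>)" for v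
  proof -
    have C: "op_C Z v = (kron Z v, v)"
      by (simp add: op_C_def kron_mat_1)
    have "v \<in> Fix (op_T_reduced A E E' Z) \<longleftrightarrow> v \<in> adjoint (op_C Z) ` ?R (op_C Z v)"
      by (auto simp: Fix_def op_T_reduced_def dest: single)
    also have "\<dots> \<longleftrightarrow> (\<exists>x w. (x, w) \<in> ?R (op_C Z v) \<and> v = kron (transpose Z) x + w)"
      unfolding adjoint_op_C image_iff by (simp add: Bex_def split_paired_Ex)
    also have "\<dots> \<longleftrightarrow> (\<exists>x. kron (transpose Z) x = 0 \<and>
        (\<exists>u\<in>op_AD A x. kron Z v = u + kron (P_mat E) x))"
    proof -
      have "v = 2 *\<^sub>R kron (transpose Z) x + w \<and> v = kron (transpose Z) x + w \<longleftrightarrow>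
          kron (transpose Z) x = 0 \<and> w = v" for x w
        by (auto simp: scaleR_2)
      then show ?thesis
        unfolding C mem_inverse_M_plus_A_iff by (metis (no_types, lifting))
    qed
    also have "\<dots> \<longleftrightarrow> (\<exists>\<xi>. ?incl v \<xi>)"
      unfolding ker incl by auto
    finally show ?thesis .
  qed

  have solution: "{x. ?incl v x} = {\<xi>} \<and>
      (let i1 = Min (UNIV :: 'n set); d1 = real (node_degree E i1) in
         resolvent (op_scale (1 / d1) (A i1)) ((1 / d1) *\<^sub>R (kron Z v $ i1)) = {\<xi>}) \<and>
      \<xi> \<in> zer (\<lambda>x. \<Sum>i\<in>UNIV. A i x)" if "?incl v \<xi>" for v \<xi>
  proof -
    define i1 where "i1 = Min (UNIV :: 'n set)"
    define d1 where "d1 = real (node_degree E i1)"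
    let ?J = "resolvent (op_scale (1 / d1) (A i1)) ((1 / d1) *\<^sub>R (kron Z v $ i1))"
    have d1: "d1 > 0"
      using pos by (simp add: d1_def)
    have nodes: "?incl v x \<longleftrightarrow> (\<forall>i. kron Z v $ i - degree_balance E $ i *\<^sub>R x \<in> A i x)" for x
    proof -
      have "?incl v x \<longleftrightarrow> kron Z v - kron_vec (degree_balance E) x \<in> op_An A x"
        by (force simp: set_plus_def)
      then show ?thesis
        by (simp add: op_An_def kron_vec_def)
    qed
    have "degree_balance E $ i1 = d1"
      using in_degree_Min[OF ord] by (simp add: degree_balance_def d1_def i1_def node_degree_def)
    then have mem: "x \<in> ?J" if "?incl v x" for x
      using that nodes mem_resolvent_op_scale_iff[OF d1] by metis
    have uniq: "x = y" if "x \<in> ?J" "y \<in> ?J" for x y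
      using that unfolding mem_resolvent_op_scale_iff[OF d1]
      by (rule monotone_op_add_scaleR_inj[OF mono d1]) simp
    have "(\<Sum>i\<in>UNIV. kron Z v $ i - degree_balance E $ i *\<^sub>R \<xi>) = 0"
      using sum_kron_decomposition[OF ord' assms(5) dec, of v] sum_degree_balance[of E]
      by (simp add: sum_subtractf scaleR_sum_left[symmetric])
    then have "0 \<in> (\<Sum>i\<in>UNIV. A i \<xi>)"
      using that nodes unfolding set_sum_alt[OF finite]
      by (intro CollectI exI[of _ "\<lambda>i. kron Z v $ i - degree_balance E $ i *\<^sub>R \<xi>"]) simp
    moreover have "{x. ?incl v x} = {\<xi>}" "?J = {\<xi>}"
      using mem uniq that by blast+
    ultimately show ?thesis
      by (simp add: zer_def Let_def i1_def d1_def)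
  qed

  have "Fix (op_T A E E' Z) = {(kron_vec 1 x, v) | x v. ?incl v x}"
    using fix_T by auto
  moreover have "Fix (op_T_reduced A E E' Z) = {v. \<exists>x. ?incl v x}"
    using fix_reduced by auto
  moreover have "\<forall>v \<in> Fix (op_T_reduced A E E' Z). \<exists>x_v. {x. ?incl v x} = {x_v} \<and>
      (let i1 = Min (UNIV :: 'n set); d1 = real (node_degree E i1) in
         resolvent (op_scale (1 / d1) (A i1)) ((1 / d1) *\<^sub>R (kron Z v $ i1)) = {x_v}) \<and>
      x_v \<in> zer (\<lambda>x. \<Sum>i\<in>UNIV. A i x)"
    using fix_reduced solution by meson
  ultimately show ?thesis
    by (intro conjI)
qed

end
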